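(* Let $\sigma$ be a node of the PI-B\&B tree. Then $$L_1(\sigma) = z(\sigma) + \min\left\{\left|\overline{T}_\sigma\right|,\ m-c\right\}$$ is a valid lower bound on the optimal value of the subproblem at node $\sigma$; that is, $L_1(\sigma)\le z(\overline{\sigma})$ for every completion $\overline{\sigma}$ of $\sigma$.
   Context: Job Sequencing and Tool Switching Problem (SSP). We are given tools $T=\{1,\dots,m\}$, jobs $J=\{1,\dots,n\}$, a magazine capacity $c<m$, and for each job $j\in J$ a required toolset $T_j\subseteq T$ with $|T_j|\le c$. Every tool is required by some job: $T=\bigcup_{j\in J}T_j$. A (partial) sequence $\sigma=(\sigma_1,\dots,\sigma_l)$ consists of pairwise distinct jobs. Let $J_\sigma=\{\sigma_1,\dots,\sigma_l\}$, $\overline{J}_\sigma=J\setminus J_\sigma$, $T_\sigma=\bigcup_{j\in J_\sigma}T_j$, and $\overline{T}_\sigma=T\setminus T_\sigma$. A magazine configuration is a set $M\subseteq T$ with $|M|=c$. A sequence of magazine configurations $\mathcal{M}=(M_1,\dots,M_l)$ covers $\sigma$ if $T_{\sigma_i}\subseteq M_i$ for $i=1,\dots,l$. Its number of tool switches is $z(\mathcal{M})=\sum_{i=2}^{l}|M_i\setminus M_{i-1}|$ (so the initial loading is free). Let $z(\sigma)$ be the minimum of $z(\mathcal{M})$ over all $\mathcal{M}$ covering $\sigma$. The SSP asks for a permutation of $J$ minimizing $z$. PI-B\&B tree. Nodes are partial sequences of jobs. The root (level $0$) is a sequence $(\sigma_1,\sigma_2)$ of two distinct jobs chosen to maximize $|T_{\sigma_1}\setminus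 T_{\sigma_2}|+|T_{\sigma_2}\setminus T_{\sigma_1}|$. At a node $\sigma=(\sigma_1,\dots,\sigma_l)$ with $\overline{J}_\sigma\neq\emptyset$, one job $j\in\overline{J}_\sigma$ maximizing $\min_{i\in\{1,\dots,l\}}|T_{\sigma_i}\cup T_j|$ is selected (ties broken in some fixed way), and the $l+1$ children of $\sigma$ are the sequences obtained by inserting $j$ into $\sigma$ at each of the $l+1$ possible positions. Leaves are complete sequences of $n$ jobs. A completion of a node $\sigma$ is any leaf of the subtree rooted at $\sigma$, i.e. any permutation of $J$ obtainable from $\sigma$ by such insertions; equivalently, any permutation of $J$ in which the jobs of $J_\sigma$ appear in the same relative order as in $\sigma$. The optimal value of the subproblem at node $\sigma$ is the minimum of $z(\overline{\sigma})$ over all completions $\overline{\sigma}$ of $\sigma$. *)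

theory Defs
  imports Main
begin

text \<open>
  Tools are the numbers in \<open>{1..m}\<close>, jobs the numbers in \<open>{1..n}\<close>, and \<open>T j\<close> is the toolset
  required by job \<open>j\<close>. Values of \<open>T\<close> outside \<open>{1..n}\<close> are irrelevant.
\<close>

definition ssp_instance :: "nat \<Rightarrow> nat \<Rightarrow> nat \<Rightarrow> (nat \<Rightarrow> nat set) \<Rightarrow> bool" where
  "ssp_instance m n c T \<longleftrightarrow>
     c < m \<and>
     (\<forall>j\<in>{1..n}. T j \<subseteq> {1..m} \<and> card (T j) \<le> c) \<and>
     {1..m} = (\<Union>j\<in>{1..n}. T j)"

definition partial_sequence :: "nat \<Rightarrow> nat list \<Rightarrow> bool" where
  "partial_sequence n \<sigma> \<longleftrightarrow> distinct \<sigma> \<and> set \<sigma> \<subseteq> {1..n}"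

definition remaining_jobs :: "nat \<Rightarrow> nat list \<Rightarrow> nat set" where
  "remaining_jobs n \<sigma> = {1..n} - set \<sigma>"

definition remaining_tools :: "nat \<Rightarrow> (nat \<Rightarrow> nat set) \<Rightarrow> nat list \<Rightarrow> nat set" where
  "remaining_tools m T \<sigma> = {1..m} - (\<Union>j\<in>set \<sigma>. T j)"


subsection \<open>Tool switches\<close>

definition configuration :: "nat \<Rightarrow> nat \<Rightarrow> nat set \<Rightarrow> bool" where
  "configuration m c M \<longleftrightarrow> M \<subseteq> {1..m} \<and> card M = c"

definition covers :: "nat \<Rightarrow> nat \<Rightarrow> (nat \<Rightarrow> nat set) \<Rightarrow> nat set list \<Rightarrow> nat list \<Rightarrow> bool" where
  "covers m c T Ms \<sigma> \<longleftrightarrow>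
     length Ms = length \<sigma> \<and>
     (\<forall>M\<in>set Ms. configuration m c M) \<and>
     (\<forall>i<length \<sigma>. T (\<sigma> ! i) \<subseteq> Ms ! i)"

text \<open>List positions start at 0, so the sum skips the free initial loading \<open>Ms ! 0\<close>.\<close>

definition switches :: "nat set list \<Rightarrow> nat" where
  "switches Ms = (\<Sum>i=1..<length Ms. card (Ms ! i - Ms ! (i - 1)))"

text \<open>
  On a nonempty set of natural numbers \<open>Inf\<close> is the minimum; lemma \<open>ex_covers\<close> below shows that
  the set is nonempty for every partial sequence of an instance.
\<close>

definition min_switches :: "nat \<Rightarrow> nat \<Rightarrow> (nat \<Rightarrow> nat set) \<Rightarrow> nat list \<Rightarrow> nat" where
  "min_switches m c T \<sigma> = Inf {switches Ms |Ms. covers m c T Ms \<sigma>}"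

definition L1 :: "nat \<Rightarrow> nat \<Rightarrow> (nat \<Rightarrow> nat set) \<Rightarrow> nat list \<Rightarrow> nat" where
  "L1 m c T \<sigma> = min_switches m c T \<sigma> + min (card (remaining_tools m T \<sigma>)) (m - c)"


subsection \<open>The PI-B\&B tree\<close>

definition is_root :: "nat \<Rightarrow> (nat \<Rightarrow> nat set) \<Rightarrow> nat list \<Rightarrow> bool" where
  "is_root n T \<rho> \<longleftrightarrow>
     (\<exists>a b. \<rho> = [a, b] \<and>
        is_arg_max (\<lambda>(a, b). card (T a - T b) + card (T b - T a))
          (\<lambda>(a, b). a \<in> {1..n} \<and> b \<in> {1..n} \<and> a \<noteq> b) (a, b))"

text \<open>
  A function \<open>sel\<close> assigns to each incomplete partial sequence the job to be inserted next. Any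
  fixed tie-breaking gives such a function, because a sequence occurs at most once in the tree.
\<close>

definition selection_rule :: "nat \<Rightarrow> (nat \<Rightarrow> nat set) \<Rightarrow> (nat list \<Rightarrow> nat) \<Rightarrow> bool" where
  "selection_rule n T sel \<longleftrightarrow>
     (\<forall>\<sigma>. partial_sequence n \<sigma> \<and> \<sigma> \<noteq> [] \<and> remaining_jobs n \<sigma> \<noteq> {} \<longrightarrow>
        is_arg_max (\<lambda>j. Min ((\<lambda>i. card (T i \<union> T j)) ` set \<sigma>))
          (\<lambda>j. j \<in> remaining_jobs n \<sigma>) (sel \<sigma>))"

definition child :: "nat \<Rightarrow> (nat list \<Rightarrow> nat) \<Rightarrow> nat list \<Rightarrow> nat list \<Rightarrow> bool" where
  "child n sel \<sigma> \<tau> \<longleftrightarrow>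
     remaining_jobs n \<sigma> \<noteq> {} \<and> (\<exists>k\<le>length \<sigma>. \<tau> = take k \<sigma> @ sel \<sigma> # drop k \<sigma>)"

definition bb_node :: "nat \<Rightarrow> (nat list \<Rightarrow> nat) \<Rightarrow> nat list \<Rightarrow> nat list \<Rightarrow> bool" where
  "bb_node n sel \<rho> \<sigma> \<longleftrightarrow> (child n sel)\<^sup>*\<^sup>* \<rho> \<sigma>"

definition completion :: "nat \<Rightarrow> (nat list \<Rightarrow> nat) \<Rightarrow> nat list \<Rightarrow> nat list \<Rightarrow> bool" where
  "completion n sel \<sigma> \<tau> \<longleftrightarrow> (child n sel)\<^sup>*\<^sup>* \<sigma> \<tau> \<and> remaining_jobs n \<tau> = {}"

text \<open>
  Again \<open>Inf\<close> is a minimum: by \<open>ex_completion\<close> below, every node has a completion.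
\<close>

definition subproblem_value ::
  "nat \<Rightarrow> nat \<Rightarrow> nat \<Rightarrow> (nat \<Rightarrow> nat set) \<Rightarrow> (nat list \<Rightarrow> nat) \<Rightarrow> nat list \<Rightarrow> nat" where
  "subproblem_value m n c T sel \<sigma> = Inf {min_switches m c T \<tau> |\<tau>. completion n sel \<sigma> \<tau>}"


subsection \<open>Well-definedness\<close>

lemma ex_covers:
  assumes inst: "ssp_instance m n c T" and \<sigma>: "partial_sequence n \<sigma>"
  shows "\<exists>Ms. covers m c T Ms \<sigma>"
proof -
  have "\<exists>M. configuration m c M \<and> T j \<subseteq> M" if "j \<in> {1..n}" for j
  proof -
    have "T j \<subseteq> {1..m}" "card (T j) \<le> c"
      using inst that unfolding ssp_instance_def by blast+
    moreover have "c < m"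
      using inst unfolding ssp_instance_def by blast
    then have "c \<le> card {1..m}"
      by simp
    ultimately
    obtain M where "T j \<subseteq> M" "M \<subseteq> {1..m}" "card M = c"
      using exists_subset_between[of "T j" c "{1..m}"] by auto
    then show ?thesis by (auto simp: configuration_def)
  qed
  then obtain f where f: "\<And>j. j \<in> {1..n} \<Longrightarrow> configuration m c (f j) \<and> T j \<subseteq> f j"
    by metis
  have sub: "set \<sigma> \<subseteq> {1..n}" using \<sigma> by (simp add: partial_sequence_def)
  have "T (\<sigma> ! i) \<subseteq> f (\<sigma> ! i)" if "i < length \<sigma>" for i
    using f sub that nth_mem by blast
  then have "covers m c T (map f \<sigma>) \<sigma>"
    using f sub by (auto simp: covers_def)
  then show ?thesis ..
qed

lemma child_partial_sequence:
  assumes sel: "selection_rule n T sel" and \<sigma>: "partial_sequence n \<sigma>" "\<sigma> \<noteq> []"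
    and ch: "child n sel \<sigma> \<tau>"
  shows "partial_sequence n \<tau> \<and> \<tau> \<noteq> [] \<and> filter (\<lambda>j. j \<in> set \<sigma>) \<tau> = \<sigma>"
proof -
  obtain k where k: "\<tau> = take k \<sigma> @ sel \<sigma> # drop k \<sigma>" and "remaining_jobs n \<sigma> \<noteq> {}"
    using ch by (auto simp: child_def)
  then have "sel \<sigma> \<in> remaining_jobs n \<sigma>"
    using sel \<sigma> by (auto simp: selection_rule_def is_arg_max_def)
  then have new: "sel \<sigma> \<in> {1..n}" "sel \<sigma> \<notin> set \<sigma>"
    by (auto simp: remaining_jobs_def)
  have st: "set \<tau> = insert (sel \<sigma>) (set \<sigma>)"
    using arg_cong[OF append_take_drop_id[of k \<sigma>], of set] unfolding k set_append by auto
  have "distinct \<tau>"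
    using new \<sigma> set_take_disj_set_drop_if_distinct[of \<sigma> k k]
    by (auto simp: k partial_sequence_def dest: in_set_takeD in_set_dropD)
  moreover have "filter (\<lambda>j. j \<in> set \<sigma>) (take k \<sigma>) = take k \<sigma>"
    "filter (\<lambda>j. j \<in> set \<sigma>) (drop k \<sigma>) = drop k \<sigma>"
    by (auto simp: filter_id_conv dest: in_set_takeD in_set_dropD)
  ultimately show ?thesis
    using new st \<sigma> by (auto simp: partial_sequence_def k)
qed

lemma descendant_partial_sequence:
  assumes sel: "selection_rule n T sel" and \<sigma>: "partial_sequence n \<sigma>" "\<sigma> \<noteq> []"
    and "(child n sel)\<^sup>*\<^sup>* \<sigma> \<tau>"
  shows "partial_sequence n \<tau> \<and> \<tau> \<noteq> [] \<and> set \<sigma> \<subseteq> set \<tau> \<and> filter (\<lambda>j. j \<in> set \<sigma>) \<tau> = \<sigma>"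
  using assms(4)
proof (induction rule: rtranclp_induct)
  case base
  then show ?case using \<sigma> by (auto simp: filter_id_conv)
next
  case (step \<tau> \<upsilon>)
  then have *: "partial_sequence n \<upsilon> \<and> \<upsilon> \<noteq> [] \<and> filter (\<lambda>j. j \<in> set \<tau>) \<upsilon> = \<tau>"
    using child_partial_sequence[OF sel] by blast
  have sub: "set \<sigma> \<subseteq> set \<tau>" using step.IH by simp
  have "filter (\<lambda>j. j \<in> set \<sigma>) \<upsilon> =
      filter (\<lambda>j. j \<in> set \<sigma>) (filter (\<lambda>j. j \<in> set \<tau>) \<upsilon>)"
    unfolding filter_filter using sub by (intro filter_cong) auto
  also have "\<dots> = filter (\<lambda>j. j \<in> set \<sigma>) \<tau>"
    using * by simp
  also have "\<dots> = \<sigma>"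
    using step.IH by simp
  finally have "filter (\<lambda>j. j \<in> set \<sigma>) \<upsilon> = \<sigma>" .
  moreover have "set \<tau> \<subseteq> set \<upsilon>"
    using * filter_is_subset[of "\<lambda>j. j \<in> set \<tau>" \<upsilon>] by simp
  ultimately show ?case
    using * sub by blast
qed

lemma bb_node_partial_sequence:
  assumes "selection_rule n T sel" "is_root n T \<rho>" "bb_node n sel \<rho> \<sigma>"
  shows "partial_sequence n \<sigma> \<and> \<sigma> \<noteq> []"
proof -
  have "partial_sequence n \<rho>" "\<rho> \<noteq> []"
    using assms(2) by (auto simp: is_root_def is_arg_max_def partial_sequence_def)
  then show ?thesis
    using descendant_partial_sequence[OF assms(1)] assms(3) unfolding bb_node_def by blast
qed

text \<open>
  The completions of a node are exactly the permutations of the jobs in which the jobs already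
  sequenced keep their relative order.
\<close>

lemma completion_iff:
  assumes sel: "selection_rule n T sel" and \<sigma>: "partial_sequence n \<sigma>" "\<sigma> \<noteq> []"
  shows "completion n sel \<sigma> \<tau> \<longleftrightarrow>
    distinct \<tau> \<and> set \<tau> = {1..n} \<and> filter (\<lambda>j. j \<in> set \<sigma>) \<tau> = \<sigma>" (is "?L \<longleftrightarrow> ?R")
proof
  assume ?L
  then have "partial_sequence n \<tau>" "filter (\<lambda>j. j \<in> set \<sigma>) \<tau> = \<sigma>" "remaining_jobs n \<tau> = {}"
    using descendant_partial_sequence[OF sel \<sigma>] unfolding completion_def by blast+
  then show ?R
    by (auto simp: partial_sequence_def remaining_jobs_def)
next
  assume ?R
  then show ?L
    using \<sigma>
  proof (induction "card (remaining_jobs n \<sigma>)" arbitrary: \<sigma>)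
    case 0
    then have "remaining_jobs n \<sigma> = {}"
      by (simp add: remaining_jobs_def)
    moreover from this have "set \<tau> \<subseteq> set \<sigma>"
      using 0 by (simp add: remaining_jobs_def)
    then have "filter (\<lambda>j. j \<in> set \<sigma>) \<tau> = \<tau>"
      by (auto simp: filter_id_conv)
    then have "\<sigma> = \<tau>"
      using 0 by simp
    ultimately show ?case by (simp add: completion_def)
  next
    case (Suc x)
    then have ne: "remaining_jobs n \<sigma> \<noteq> {}" by auto
    define j where "j = sel \<sigma>"
    have j: "j \<in> remaining_jobs n \<sigma>"
      using sel Suc.prems ne by (auto simp: selection_rule_def is_arg_max_def j_def)
    then have "j \<in> set \<tau>" using Suc.prems by (auto simp: remaining_jobs_def)
    then obtain A B where \<tau>: "\<tau> = A @ j # B" by (auto simp: in_set_conv_decomp)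
    let ?A = "filter (\<lambda>i. i \<in> set \<sigma>) A" and ?B = "filter (\<lambda>i. i \<in> set \<sigma>) B"
    define \<upsilon> where "\<upsilon> = ?A @ j # ?B"
    have s: "?A @ ?B = \<sigma>"
      using Suc.prems(1) j by (simp add: \<tau> remaining_jobs_def)
    have "take (length ?A) (?A @ ?B) = ?A" "drop (length ?A) (?A @ ?B) = ?B"
      "length ?A \<le> length (?A @ ?B)"
      by simp_all
    then have "take (length ?A) \<sigma> = ?A" "drop (length ?A) \<sigma> = ?B" "length ?A \<le> length \<sigma>"
      unfolding s .
    then have ch: "child n sel \<sigma> \<upsilon>"
      using ne unfolding child_def \<upsilon>_def j_def
      by (intro conjI exI[of _ "length (filter (\<lambda>i. i \<in> set \<sigma>) A)"]) simp_all
    have \<upsilon>: "partial_sequence n \<upsilon>" "\<upsilon> \<noteq> []"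
      using child_partial_sequence[OF sel Suc.prems(2,3) ch] by auto
    have set: "set \<upsilon> = insert j (set \<sigma>)"
      using arg_cong[OF s, of set] by (auto simp: \<upsilon>_def)
    have "filter (\<lambda>i. i \<in> set \<upsilon>) A = ?A" "filter (\<lambda>i. i \<in> set \<upsilon>) B = ?B"
      using Suc.prems(1) unfolding \<tau> set by (auto intro!: filter_cong)
    then have filt: "filter (\<lambda>i. i \<in> set \<upsilon>) \<tau> = \<upsilon>"
      by (simp add: \<tau>) (simp add: \<upsilon>_def)
    have "remaining_jobs n \<upsilon> = remaining_jobs n \<sigma> - {j}"
      by (auto simp: remaining_jobs_def set)
    then have "x = card (remaining_jobs n \<upsilon>)"
      using Suc.hyps(2) j by (simp add: remaining_jobs_def)
    then have "completion n sel \<upsilon> \<tau>"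
      using Suc.hyps(1) Suc.prems(1) filt \<upsilon> by blast
    then show ?case
      using ch by (auto simp: completion_def intro: converse_rtranclp_into_rtranclp)
  qed
qed

lemma ex_completion:
  assumes sel: "selection_rule n T sel" and \<sigma>: "partial_sequence n \<sigma>" "\<sigma> \<noteq> []"
  shows "\<exists>\<tau>. completion n sel \<sigma> \<tau>"
proof -
  obtain xs where xs: "set xs = {1..n} - set \<sigma>" "distinct xs"
    using finite_distinct_list[of "{1..n} - set \<sigma>"] by auto
  have "filter (\<lambda>j. j \<in> set \<sigma>) xs = []"
    using xs by (auto simp: filter_empty_conv)
  moreover have "filter (\<lambda>j. j \<in> set \<sigma>) \<sigma> = \<sigma>"
    by (auto simp: filter_id_conv)
  ultimately have "completion n sel \<sigma> (\<sigma> @ xs)"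
    using xs \<sigma> by (auto simp: completion_iff[OF sel \<sigma>] partial_sequence_def)
  then show ?thesis ..
qed

end

theory Submission imports Defs begin

text \<open>
  Think of a tool as paying one unit each time it enters the magazine, the initial loading of
  \<open>c\<close> tools included, so that a sequence of configurations pays \<open>c\<close> plus its number of switches.
  Fix an optimal sequence of configurations for a completion \<open>\<tau>\<close> of \<open>\<sigma>\<close>, and a set \<open>R\<close> of
  \<open>min |remaining tools| (m - c)\<close> tools that no job of \<open>\<sigma>\<close> requires. Every tool is required by
  some job of \<open>\<tau>\<close>, so each tool of \<open>R\<close> pays at least once. Erasing \<open>R\<close> from all configurations
  therefore saves at least \<open>card R\<close>.

  Erasing may leave sets with fewer than \<open>c\<close> elements, which are not configurations. Since
  \<open>card R \<le> m - c\<close>, at least \<open>c\<close> tools are left, each of them loaded at some time, and the free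
  slots can be filled at no cost: before the magazine is full for the first time, load tools early
  instead of at the time of their first use, and from then on, keep old tools instead of
  discarding them (lemmas \<open>pad_full\<close> and \<open>pad\<close>). Finally, omitting the jobs outside \<open>\<sigma>\<close> costs
  nothing by a triangle inequality (\<open>loads_drop\<close>). What results is a sequence of
  configurations that covers \<open>\<sigma>\<close> and has at least \<open>card R\<close> switches fewer than the optimum
  for \<open>\<tau>\<close>.
\<close>

section \<open>Counting loads instead of switches\<close>

text \<open>
  Here \<open>B\<close> is the content of the magazine before the sequence starts; \<open>B = {}\<close> charges the initial
  loading as well. The sets may have any size, which is needed for sequences with erased tools.
\<close>

fun loads :: "'a set \<Rightarrow> 'a set list \<Rightarrow> nat" where
  "loads B [] = 0"
| "loads B (M # Ms) = card (M - B) + loads M Ms"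

lemma switches_Cons: "switches (M # Ms) = loads M Ms"
proof -
  have "(\<Sum>i<length Ms. card (Ms ! i - (M # Ms) ! i)) = loads M Ms"
    by (induction Ms arbitrary: M) (simp_all add: sum.lessThan_Suc_shift del: sum.lessThan_Suc)
  moreover have "switches (M # Ms) = (\<Sum>i<length Ms. card (Ms ! i - (M # Ms) ! i))"
    using sum.shift_bounds_Suc_ivl[of "\<lambda>i. card ((M # Ms) ! i - (M # Ms) ! (i - 1))" 0 "length Ms"]
    by (simp add: switches_def lessThan_atLeast0)
  ultimately show ?thesis by simp
qed

lemma switches_le_loads: "switches Ms \<le> loads B Ms"
  by (cases Ms) (simp_all add: switches_Cons, simp add: switches_def)

lemma loads_empty_le_switches:
  assumes "\<forall>M\<in>set Ms. card M \<le> c"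
  shows "loads {} Ms \<le> c + switches Ms"
  using assms by (cases Ms) (simp_all add: switches_Cons)

text \<open>
  A tool that is missing from \<open>B\<close> and needed at once is missing from \<open>P\<close> or was added on the way
  from \<open>B\<close> to \<open>P\<close>: a detour through \<open>P\<close> never saves loads.
\<close>

lemma loads_triangle:
  assumes "finite P" "\<forall>M\<in>set Ms. finite M"
  shows "loads B Ms \<le> card (P - B) + loads P Ms"
proof (cases Ms)
  case (Cons M Ms')
  have "card (M - B) \<le> card ((P - B) \<union> (M - P))"
    using assms Cons by (intro card_mono) auto
  also have "\<dots> \<le> card (P - B) + card (M - P)"
    by (rule card_Un_le)
  finally show ?thesis using Cons by simp
qed simp

lemma loads_antimono:
  assumes "N \<subseteq> P" "finite N" "\<forall>M\<in>set Ms. finite M"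
  shows "loads P Ms \<le> loads N Ms"
proof -
  have "card (N - P) = 0"
    using assms(1) by (metis Diff_eq_empty_iff card.empty)
  then show ?thesis using loads_triangle[OF assms(2,3), of P] by simp
qed

text \<open>
  By the triangle inequality, skipping a configuration never costs loads. The relation \<open>R\<close> keeps
  each remaining job together with the configuration that serves it.
\<close>

lemma loads_drop:
  assumes "list_all2 R xs Ms" "\<forall>M\<in>set Ms. finite M"
  shows "\<exists>Qs. list_all2 R (filter p xs) Qs \<and> set Qs \<subseteq> set Ms \<and> loads B Qs \<le> loads B Ms"
  using assms
proof (induction arbitrary: B rule: list_all2_induct)
  case (Cons x xs M Ms)
  obtain Qs where Qs: "list_all2 R (filter p xs) Qs" "set Qs \<subseteq> set Ms" "loads M Qs \<le> loads M Ms"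
    using Cons.IH[of M] Cons.prems by auto
  show ?case
  proof (cases "p x")
    case True
    then show ?thesis using Qs Cons.hyps by (intro exI[of _ "M # Qs"]) auto
  next
    case False
    have "loads B Qs \<le> card (M - B) + loads M Qs"
      using Cons.prems Qs(2) by (intro loads_triangle) auto
    then show ?thesis using Qs False by (intro exI[of _ Qs]) auto
  qed
qed simp

text \<open>
  Loads are counted tool by tool, so the tools in \<open>K\<close> can be charged separately from the others.
\<close>

lemma loads_split:
  assumes "\<forall>M\<in>set Ms. finite M"
  shows "loads B Ms =
    loads (B \<inter> K) (map (\<lambda>M. M \<inter> K) Ms) + loads (B - K) (map (\<lambda>M. M - K) Ms)"
  using assms
proof (induction Ms arbitrary: B)
  case (Cons M Ms)
  have "card (M - B) = card (((M \<inter> K) - (B \<inter> K)) \<union> ((M - K) - (B - K)))"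
    by (intro arg_cong[of _ _ card]) blast
  also have "\<dots> = card ((M \<inter> K) - (B \<inter> K)) + card ((M - K) - (B - K))"
    using Cons.prems by (intro card_Un_disjoint) auto
  finally show ?case using Cons by simp
qed simp

lemma card_Union_le_loads:
  assumes "\<forall>M\<in>set Ms. finite M"
  shows "card (\<Union>(set Ms) - B) \<le> loads B Ms"
  using assms
proof (induction Ms arbitrary: B)
  case (Cons M Ms)
  have "card (\<Union>(set (M # Ms)) - B) \<le> card ((M - B) \<union> (\<Union>(set Ms) - M))"
    using Cons.prems by (intro card_mono) auto
  also have "\<dots> \<le> card (M - B) + card (\<Union>(set Ms) - M)"
    by (rule card_Un_le)
  finally show ?case using Cons.IH[of M] Cons.prems by simp
qed simp

section \<open>Filling free slots at no cost\<close>

text \<open>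
  Starting from a full magazine, the free slots beside \<open>N\<close> can be filled with tools that are
  already there. This loads nothing new, and a larger magazine only helps later.
\<close>

lemma pad_full:
  assumes "finite U" "A \<subseteq> U" "card A = c" "\<forall>N\<in>set Ns. N \<subseteq> U \<and> card N \<le> c"
  shows "\<exists>Ps. list_all2 (\<lambda>N P. N \<subseteq> P \<and> P \<subseteq> U \<and> card P = c) Ns Ps \<and> loads A Ps \<le> loads A Ns"
  using assms(2-)
proof (induction Ns arbitrary: A)
  case (Cons N Ns)
  have fin: "finite A" "finite N" "\<forall>M\<in>set Ns. finite M"
    using Cons.prems finite_subset[OF _ assms(1)] by auto
  then have "card A \<le> card (N \<union> A)"
    by (intro card_mono) auto
  then obtain P where P: "N \<subseteq> P" "P \<subseteq> N \<union> A" "card P = c"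
    using exists_subset_between[of N c "N \<union> A"] Cons.prems fin by auto
  have "P \<subseteq> U" using P(2) Cons.prems by auto
  then obtain Ps where Ps: "list_all2 (\<lambda>N P. N \<subseteq> P \<and> P \<subseteq> U \<and> card P = c) Ns Ps"
    "loads P Ps \<le> loads P Ns"
    using Cons.IH[of P] P(3) Cons.prems by auto
  have "P - A = N - A" using P by blast
  moreover have "loads P Ns \<le> loads N Ns"
    using P(1) fin by (intro loads_antimono) auto
  ultimately show ?case
    using P Ps \<open>P \<subseteq> U\<close> by (intro exI[of _ "P # Ps"]) auto
qed simp

text \<open>
  A magazine \<open>B\<close> with free slots is first extended to a full one, \<open>A\<close>. Its new tools are the
  first \<open>c - card B\<close> different ones that \<open>Ns\<close> requires in addition to \<open>B\<close>. The sequence \<open>Ns\<close> pays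
  for each of them anyway, so paying for them in advance costs nothing.
\<close>

lemma pad:
  assumes "finite U" "B \<subseteq> U" "card B \<le> c" "c \<le> card (B \<union> \<Union>(set Ns))"
    and "\<forall>N\<in>set Ns. N \<subseteq> U \<and> card N \<le> c"
  shows "\<exists>A Ps. B \<subseteq> A \<and> A \<subseteq> U \<and> card A = c \<and>
    list_all2 (\<lambda>N P. N \<subseteq> P \<and> P \<subseteq> U \<and> card P = c) Ns Ps \<and>
    card (A - B) + loads A Ps \<le> loads B Ns"
  using assms(2-)
proof (induction Ns arbitrary: B)
  case Nil
  then show ?case by (intro exI[of _ B] exI[of _ "[]"]) auto
next
  case (Cons N Ns)
  have fin: "finite B" "finite N" "\<forall>M\<in>set Ns. finite M"
    using Cons.prems finite_subset[OF _ assms(1)] by auto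
  show ?case
  proof (cases "c \<le> card (B \<union> N)")
    case True
    then obtain A where A: "B \<subseteq> A" "A \<subseteq> B \<union> N" "card A = c"
      using exists_subset_between[of B c "B \<union> N"] Cons.prems fin by auto
    have "A \<subseteq> U" using A(2) Cons.prems by auto
    then obtain Ps where
      Ps: "list_all2 (\<lambda>N P. N \<subseteq> P \<and> P \<subseteq> U \<and> card P = c) (N # Ns) Ps"
      "loads A Ps \<le> loads A (N # Ns)"
      using pad_full[OF assms(1), of A c "N # Ns"] A(3) Cons.prems by blast
    have "N - B = (A - B) \<union> (N - A)" using A by blast
    moreover have "finite (A - B)" using A(2) fin finite_subset[of A "B \<union> N"] by simp
    ultimately have "card (N - B) = card (A - B) + card (N - A)"
      using fin card_Un_disjoint[of "A - B" "N - A"] by auto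
    then show ?thesis
      using A Ps \<open>A \<subseteq> U\<close> by (intro exI[of _ A] exI[of _ Ps]) auto
  next
    case False
    then obtain A Ps where A: "B \<union> N \<subseteq> A" "A \<subseteq> U" "card A = c"
      and Ps: "list_all2 (\<lambda>N P. N \<subseteq> P \<and> P \<subseteq> U \<and> card P = c) Ns Ps"
        "card (A - (B \<union> N)) + loads A Ps \<le> loads (B \<union> N) Ns"
      using Cons.IH[of "B \<union> N"] Cons.prems by (auto simp: Un_assoc)
    have "card (A - B) \<le> card ((N - B) \<union> (A - (B \<union> N)))"
      using fin finite_subset[OF A(2) assms(1)] by (intro card_mono) auto
    also have "\<dots> \<le> card (N - B) + card (A - (B \<union> N))"
      by (rule card_Un_le)
    finally have "card (A - B) \<le> card (N - B) + card (A - (B \<union> N))" .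
    moreover have "loads (B \<union> N) Ns \<le> loads N Ns"
      using fin by (intro loads_antimono) auto
    \<comment> \<open>\<open>A\<close> is already loaded when \<open>N\<close> is due, so staying with \<open>A\<close> is free.\<close>
    ultimately show ?thesis
      using A Ps by (intro exI[of _ A] exI[of _ "A # Ps"]) auto
  qed
qed

section \<open>The lower bound\<close>

lemma min_switches_le: "covers m c T Ms \<sigma> \<Longrightarrow> min_switches m c T \<sigma> \<le> switches Ms"
  unfolding min_switches_def by (intro cInf_lower) auto

lemma min_switches_attained:
  assumes "ssp_instance m n c T" "partial_sequence n \<sigma>"
  obtains Ms where "covers m c T Ms \<sigma>" "switches Ms = min_switches m c T \<sigma>"
proof -
  have "{switches Ms |Ms. covers m c T Ms \<sigma>} \<noteq> {}"
    using ex_covers[OF assms] by blast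
  then have "min_switches m c T \<sigma> \<in> {switches Ms |Ms. covers m c T Ms \<sigma>}"
    unfolding min_switches_def by (rule Inf_nat_def1)
  then show ?thesis using that by auto
qed

text \<open>
  A node is the subsequence of its completion that keeps the jobs already sequenced, so \<open>p\<close> stands
  for being one of these jobs. The minimum in \<open>L1\<close> makes \<open>R\<close> as large as padding permits: at least
  \<open>c\<close> tools must remain in \<open>K\<close>.
\<close>

lemma L1_filter_le_min_switches:
  assumes inst: "ssp_instance m n c T" and \<tau>: "distinct \<tau>" "set \<tau> = {1..n}"
  shows "L1 m c T (filter p \<tau>) \<le> min_switches m c T \<tau>"
proof -
  let ?\<sigma> = "filter p \<tau>"
  obtain Ms where Ms: "covers m c T Ms \<tau>" "switches Ms = min_switches m c T \<tau>"
    using min_switches_attained[OF inst, of \<tau>] \<tau> by (auto simp: partial_sequence_def)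
  have conf: "\<forall>M\<in>set Ms. M \<subseteq> {1..m} \<and> card M = c"
    and cov: "list_all2 (\<lambda>j M. T j \<subseteq> M) \<tau> Ms"
    using Ms(1) by (auto simp: covers_def configuration_def list_all2_conv_all_nth)
  have fin: "\<forall>M\<in>set Ms. finite M"
    using conf by (auto intro: finite_subset)
  have "T j \<subseteq> \<Union>(set Ms)" if "j \<in> set \<tau>" for j
    using cov that
    by (metis (no_types, lifting) list_all2_conv_all_nth in_set_conv_nth Union_upper subset_trans)
  then have "(\<Union>j\<in>{1..n}. T j) \<subseteq> \<Union>(set Ms)"
    unfolding \<tau>(2) by (rule UN_least)
  moreover have "(\<Union>j\<in>{1..n}. T j) = {1..m}"
    using inst by (simp add: ssp_instance_def)
  moreover have "\<Union>(set Ms) \<subseteq> {1..m}"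
    using conf by (intro Union_least) simp
  ultimately have all: "\<Union>(set Ms) = {1..m}"
    by simp
  define r where "r = min (card (remaining_tools m T ?\<sigma>)) (m - c)"
  obtain R where R: "R \<subseteq> remaining_tools m T ?\<sigma>" "card R = r"
    using obtain_subset_with_card_n[of r "remaining_tools m T ?\<sigma>"] by (auto simp: r_def)
  have Rm: "R \<subseteq> {1..m}" using R(1) by (auto simp: remaining_tools_def)
  define K where "K = {1..m} - R"
  have finK: "finite K" by (simp add: K_def)
  have "card K = m - r"
    using Rm R(2) by (simp add: K_def card_Diff_subset finite_subset[OF Rm])
  moreover have "c \<le> m" using inst by (simp add: ssp_instance_def)
  ultimately have cK: "c \<le> card K" by (simp add: r_def)
  define Ns where "Ns = map (\<lambda>M. M \<inter> K) Ms"
  have "\<Union>(set (map (\<lambda>M. M - K) Ms)) = R"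
  proof -
    have "\<Union>(set (map (\<lambda>M. M - K) Ms)) = \<Union>(set Ms) - K" by auto
    also have "\<dots> = R" unfolding all K_def using Rm by blast
    finally show ?thesis .
  qed
  then have "r \<le> loads {} (map (\<lambda>M. M - K) Ms)"
    using card_Union_le_loads[of "map (\<lambda>M. M - K) Ms" "{}"] fin R(2) by simp
  then have saved: "loads {} Ns + r \<le> loads {} Ms"
    using loads_split[OF fin, of "{}" K] by (simp add: Ns_def)
  have "\<Union>(set Ns) = K"
  proof -
    have "\<Union>(set Ns) = \<Union>(set Ms) \<inter> K" by (auto simp: Ns_def)
    also have "\<dots> = K" unfolding all K_def by blast
    finally show ?thesis .
  qed
  moreover have "\<forall>N\<in>set Ns. N \<subseteq> K \<and> card N \<le> c"
  proof -
    have "card (M \<inter> K) \<le> c" if "M \<in> set Ms" for M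
      using card_mono[of M "M \<inter> K"] fin conf that by simp
    then show ?thesis by (simp add: Ns_def)
  qed
  ultimately obtain A Ps where
    Ps: "list_all2 (\<lambda>N P. N \<subseteq> P \<and> P \<subseteq> K \<and> card P = c) Ns Ps"
    and padded: "c + loads A Ps \<le> loads {} Ns"
    using pad[of K "{}" c Ns] cK finK by auto
  have "list_all2 (\<lambda>j P. T j \<inter> K \<subseteq> P \<and> P \<subseteq> K \<and> card P = c) \<tau> Ps"
  proof (rule list_all2_all_nthI)
    have len: "length \<tau> = length Ms" "length Ms = length Ps"
      using list_all2_lengthD[OF cov] list_all2_lengthD[OF Ps] by (simp_all add: Ns_def)
    then show "length \<tau> = length Ps" by simp
    fix i assume i: "i < length \<tau>"
    have "T (\<tau> ! i) \<subseteq> Ms ! i"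
      using list_all2_nthD[OF cov i] .
    moreover have "Ms ! i \<inter> K \<subseteq> Ps ! i \<and> Ps ! i \<subseteq> K \<and> card (Ps ! i) = c"
      using list_all2_nthD[OF Ps, of i] i len by (simp add: Ns_def)
    ultimately show "T (\<tau> ! i) \<inter> K \<subseteq> Ps ! i \<and> Ps ! i \<subseteq> K \<and> card (Ps ! i) = c"
      by blast
  qed
  moreover have "\<forall>P\<in>set Ps. finite P"
    using Ps finite_subset[OF _ finK]
    unfolding list_all2_conv_all_nth by (metis in_set_conv_nth)
  ultimately obtain Qs where
    Qs: "list_all2 (\<lambda>j P. T j \<inter> K \<subseteq> P \<and> P \<subseteq> K \<and> card P = c) ?\<sigma> Qs" "loads A Qs \<le> loads A Ps"
    using loads_drop by blast
  have keep: "T j \<inter> K = T j" if "j \<in> set ?\<sigma>" for j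
  proof -
    have "T j \<subseteq> {1..m}" using inst \<tau>(2) that by (auto simp: ssp_instance_def)
    then show ?thesis using R(1) that by (auto simp: K_def remaining_tools_def)
  qed
  have len: "length Qs = length ?\<sigma>"
    using Qs(1) by (simp add: list_all2_lengthD)
  have Q: "T (?\<sigma> ! i) \<subseteq> Qs ! i \<and> configuration m c (Qs ! i)" if "i < length ?\<sigma>" for i
    using list_all2_nthD[OF Qs(1) that] keep[OF nth_mem[OF that]]
    by (auto simp: configuration_def K_def)
  have "covers m c T Qs ?\<sigma>"
    unfolding covers_def using len Q by (auto simp: in_set_conv_nth)
  then have "min_switches m c T ?\<sigma> + r \<le> switches Qs + r"
    using min_switches_le by simp
  also have "\<dots> \<le> loads A Ps + r"
    using Qs(2) switches_le_loads[of Qs A] by simp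
  also have "\<dots> \<le> switches Ms"
    using saved padded loads_empty_le_switches[of Ms c] conf by simp
  finally show ?thesis
    using Ms(2) by (simp add: L1_def r_def)
qed

theorem proposition1:
  fixes m n c :: nat
    and T :: "nat \<Rightarrow> nat set"
    and sel :: "nat list \<Rightarrow> nat"
    and \<rho> \<sigma> :: "nat list"
  assumes "ssp_instance m n c T"
    and "selection_rule n T sel"
    and "is_root n T \<rho>"
    and "bb_node n sel \<rho> \<sigma>"
  shows "L1 m c T \<sigma> \<le> subproblem_value m n c T sel \<sigma> \<and>
    (\<forall>\<tau>. completion n sel \<sigma> \<tau> \<longrightarrow> L1 m c T \<sigma> \<le> min_switches m c T \<tau>)"
proof -
  have \<sigma>: "partial_sequence n \<sigma>" "\<sigma> \<noteq> []"
    using bb_node_partial_sequence[OF assms(2-4)] by auto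
  have bound: "L1 m c T \<sigma> \<le> min_switches m c T \<tau>" if "completion n sel \<sigma> \<tau>" for \<tau>
    using that L1_filter_le_min_switches[OF assms(1), of \<tau> "\<lambda>j. j \<in> set \<sigma>"]
    unfolding completion_iff[OF assms(2) \<sigma>] by simp
  moreover have "L1 m c T \<sigma> \<le> subproblem_value m n c T sel \<sigma>"
    unfolding subproblem_value_def
    using ex_completion[OF assms(2) \<sigma>] bound by (intro cInf_greatest) auto
  ultimately show ?thesis by blast
qed

end
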